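(* Let $\varepsilon>0$. Then $c_0(\ell^\infty)$ has the $(2+\varepsilon)$-SEP. Moreover, $c_0(\ell^\infty)$ is $(2+\varepsilon)$-complemented in every Banach space $Y$ that contains $c_0(\ell^\infty)$ as a closed linear subspace and for which $Y/c_0(\ell^\infty)$ is separable.
   Context: A Banach space $Z$ has the $\lambda$-SEP ($\lambda$-Separable Extension Property) if for all separable Banach spaces $Y$, all closed linear subspaces $X\subset Y$, and all bounded linear operators $T:X\to Z$, there exists a bounded linear operator $\tilde T:Y\to Z$ extending $T$ with $\|\tilde T\|\le\lambda\|T\|$. For a Banach space $Z$, $c_0(Z)$ is the space of all sequences $(z_j)$ in $Z$ with $\|z_j\|\to0$, with norm $\sup_j\|z_j\|$. A closed subspace $X$ of a Banach space $Y$ is $\lambda$-complemented in $Y$ if there is a bounded linear projection $P$ of $Y$ onto $X$ with $\|P\|\le\lambda$. *)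

theory Defs
  imports "HOL-Analysis.Analysis"
begin

section \<open>Banach spaces over a scalar field\<close>

text \<open>
  A type of class \<open>banach\<close> is a real Banach space. To treat real and complex scalars alike, a Banach
  space over \<open>'k\<close> is a type of class \<open>banach\<close> together with a scalar multiplication by \<open>'k\<close> that
  extends \<open>scaleR\<close> and for which the norm is homogeneous. For \<open>'k = real\<close> the only such
  multiplication is \<open>scaleR\<close> itself, see \<open>banach_scaling_real\<close>.
\<close>

definition banach_scaling :: "('k::real_normed_field \<Rightarrow> 'v::banach \<Rightarrow> 'v) \<Rightarrow> bool" where
  "banach_scaling s \<longleftrightarrow>
     vector_space s \<and> (\<forall>r v. s (of_real r) v = r *\<^sub>R v) \<and> (\<forall>a v. norm (s a v) = norm a * norm v)"

lemma banach_scaling_real: "banach_scaling (s :: real \<Rightarrow> 'v::banach \<Rightarrow> 'v) \<longleftrightarrow> s = scaleR"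
proof
  assume "banach_scaling s"
  then have "s (of_real r) v = r *\<^sub>R v" for r v
    by (simp add: banach_scaling_def)
  then show "s = scaleR"
    by (intro ext) simp
next
  have "vector_space (scaleR :: real \<Rightarrow> 'v \<Rightarrow> 'v)" ..
  then show "s = scaleR \<Longrightarrow> banach_scaling s"
    by (simp add: banach_scaling_def)
qed

text \<open>The operator is represented by a total function; its values outside the domain \<open>X\<close> are irrelevant.\<close>

definition bounded_linear_op_on ::
  "('k \<Rightarrow> 'v \<Rightarrow> 'v) \<Rightarrow> ('k \<Rightarrow> 'w \<Rightarrow> 'w) \<Rightarrow> 'v::real_normed_vector set \<Rightarrow> ('v \<Rightarrow> 'w::real_normed_vector) \<Rightarrow> bool"
  where "bounded_linear_op_on s t X T \<longleftrightarrow>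
     (\<forall>x\<in>X. \<forall>y\<in>X. T (x + y) = T x + T y) \<and> (\<forall>a. \<forall>x\<in>X. T (s a x) = t a (T x)) \<and>
     (\<exists>K. \<forall>x\<in>X. norm (T x) \<le> K * norm x)"

definition onorm_on :: "'v::real_normed_vector set \<Rightarrow> ('v \<Rightarrow> 'w::real_normed_vector) \<Rightarrow> real" where
  "onorm_on X T = (SUP x\<in>X. norm (T x) / norm x)"

lemma onorm_on_UNIV: "onorm_on UNIV T = onorm T"
  by (simp add: onorm_on_def onorm_def)

section \<open>The separable extension property and complementation\<close>

text \<open>
  HOL cannot quantify over types inside a formula, so the type \<open>'y\<close> of the ambient separable space
  is a parameter. The property for all separable Banach spaces is the statement
  \<open>separable_extension_property TYPE('y) \<lambda> t\<close> with \<open>'y\<close> a free type variable.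
\<close>

definition separable_extension_property ::
  "'y::banach itself \<Rightarrow> real \<Rightarrow> ('k::real_normed_field \<Rightarrow> 'z::banach \<Rightarrow> 'z) \<Rightarrow> bool" where
  "separable_extension_property _ l t \<longleftrightarrow>
     (separable_space (euclidean :: 'y topology) \<longrightarrow>
      (\<forall>(s :: 'k \<Rightarrow> 'y \<Rightarrow> 'y) X (T :: 'y \<Rightarrow> 'z).
         banach_scaling s \<and> module.subspace s X \<and> closed X \<and> bounded_linear_op_on s t X T \<longrightarrow>
         (\<exists>T'. bounded_linear_op_on s t UNIV T' \<and> (\<forall>x\<in>X. T' x = T x) \<and>
               onorm T' \<le> l * onorm_on X T)))"

definition complemented ::
  "real \<Rightarrow> ('k::real_normed_field \<Rightarrow> 'y::banach \<Rightarrow> 'y) \<Rightarrow> 'y set \<Rightarrow> bool" where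
  "complemented l s X \<longleftrightarrow>
     (\<exists>P. bounded_linear_op_on s s UNIV P \<and> range P = X \<and> (\<forall>x\<in>X. P x = x) \<and> onorm P \<le> l)"

definition isometric_embedding ::
  "('k::real_normed_field \<Rightarrow> 'z::banach \<Rightarrow> 'z) \<Rightarrow> ('k \<Rightarrow> 'y::banach \<Rightarrow> 'y) \<Rightarrow> ('z \<Rightarrow> 'y) \<Rightarrow> bool" where
  "isometric_embedding t s J \<longleftrightarrow>
     Vector_Spaces.linear t s J \<and> (\<forall>z. norm (J z) = norm z)"

definition cosets :: "'y::ab_group_add set \<Rightarrow> 'y set set" where
  "cosets X = range (\<lambda>y. (+) y ` X)"

text \<open>
  For cosets \<open>A\<close> and \<open>B\<close> of \<open>X\<close>, the quotient norm of \<open>A - B\<close> is the infimum of \<open>norm (a - b)\<close> over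
  \<open>a \<in> A\<close> and \<open>b \<in> B\<close>, which is \<open>setdist A B\<close>.
\<close>

lemma setdist_cosets:
  fixes X :: "'y::real_normed_vector set"
  assumes X: "subspace X"
  shows "setdist ((+) y ` X) ((+) z ` X) = (INF x\<in>X. norm (y - z + x))"
proof -
  have ne: "X \<noteq> {}" using subspace_0[OF X] by auto
  have "{dist a b |a b. a \<in> (+) y ` X \<and> b \<in> (+) z ` X} = (\<lambda>x. norm (y - z + x)) ` X"
  proof (intro subset_antisym subsetI)
    fix r assume "r \<in> {dist a b |a b. a \<in> (+) y ` X \<and> b \<in> (+) z ` X}"
    then obtain u v where uv: "u \<in> X" "v \<in> X" "r = dist (y + u) (z + v)" by auto
    then have "r = norm (y - z + (u - v))" by (simp add: dist_norm algebra_simps)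
    then show "r \<in> (\<lambda>x. norm (y - z + x)) ` X"
      using subspace_diff[OF X uv(1,2)] by blast
  next
    fix r assume "r \<in> (\<lambda>x. norm (y - z + x)) ` X"
    then obtain x where x: "x \<in> X" "r = norm (y - z + x)" by auto
    then have "r = dist (y + x) (z + 0)" by (simp add: dist_norm algebra_simps)
    then show "r \<in> {dist a b |a b. a \<in> (+) y ` X \<and> b \<in> (+) z ` X}"
      using x(1) subspace_0[OF X] by blast
  qed
  then show ?thesis using ne by (simp add: setdist_def)
qed

lemma Metric_space_cosets:
  fixes X :: "'y::real_normed_vector set"
  assumes X: "subspace X" and cl: "closed X"
  shows "Metric_space (cosets X) setdist"
proof
  have ne: "X \<noteq> {}" using subspace_0[OF X] by auto
  have inf: "setdist ((+) y ` X) ((+) z ` X) = infdist (y - z) X" for y z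
  proof -
    have "(\<lambda>x. norm (y - z + x)) ` X = dist (y - z) ` X"
    proof (intro subset_antisym subsetI)
      fix r assume "r \<in> (\<lambda>x. norm (y - z + x)) ` X"
      then obtain x where "x \<in> X" "r = dist (y - z) (- x)" by (auto simp: dist_norm)
      then show "r \<in> dist (y - z) ` X" using subspace_neg[OF X] by blast
    next
      fix r assume "r \<in> dist (y - z) ` X"
      then obtain x where "x \<in> X" "r = norm (y - z + - x)" by (auto simp: dist_norm)
      then show "r \<in> (\<lambda>x. norm (y - z + x)) ` X" using subspace_neg[OF X] by blast
    qed
    then show ?thesis using ne by (simp add: setdist_cosets[OF X] infdist_def)
  qed
  have coset_eq: "(+) y ` X = (+) z ` X" if "y - z \<in> X" for y z
  proof -
    have "(+) u ` X \<subseteq> (+) v ` X" if "u - v \<in> X" for u v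
    proof
      fix w assume "w \<in> (+) u ` X"
      then obtain x where "x \<in> X" "w = v + ((u - v) + x)" by auto
      then show "w \<in> (+) v ` X" using subspace_add[OF X \<open>u - v \<in> X\<close>] by blast
    qed
    moreover have "z - y \<in> X" using subspace_neg[OF X that] by simp
    ultimately show ?thesis using that by blast
  qed
  show "0 \<le> setdist A B" for A B :: "'y set" by (rule setdist_pos_le)
  show "setdist A B = setdist B A" for A B :: "'y set" by (rule setdist_sym)
  show "setdist A B = 0 \<longleftrightarrow> A = B" if AB: "A \<in> cosets X" "B \<in> cosets X" for A B
  proof -
    obtain y z where yz: "A = (+) y ` X" "B = (+) z ` X" using AB by (auto simp: cosets_def)
    show ?thesis
    proof
      assume "setdist A B = 0"
      then have "y - z \<in> X" using in_closed_iff_infdist_zero[OF cl ne] by (simp add: yz inf)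
      then show "A = B" by (simp add: yz coset_eq)
    next
      assume "A = B"
      then show "setdist A B = 0" using subspace_0[OF X] by (simp add: yz(2) inf)
    qed
  qed
  have near: "\<exists>a\<in>X. dist u a < r" if "infdist u X < r" for u r
    using cInf_lessD[of "dist u ` X" r] that ne by (auto simp: infdist_notempty)
  show "setdist A C \<le> setdist A B + setdist B C"
    if ABC: "A \<in> cosets X" "B \<in> cosets X" "C \<in> cosets X" for A B C
  proof -
    obtain y z w where yz: "A = (+) y ` X" "B = (+) z ` X" "C = (+) w ` X"
      using ABC by (auto simp: cosets_def)
    have "infdist (y - w) X \<le> r" if "infdist (y - z) X + infdist (z - w) X < r" for r
    proof -
      define e where "e = r - (infdist (y - z) X + infdist (z - w) X)"
      have "e > 0" using that by (simp add: e_def)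
      then obtain a b where a: "a \<in> X" "dist (y - z) a < infdist (y - z) X + e/2"
        and b: "b \<in> X" "dist (z - w) b < infdist (z - w) X + e/2"
        using near[of "y - z" "infdist (y - z) X + e/2"] near[of "z - w" "infdist (z - w) X + e/2"]
        by auto
      have "infdist (y - w) X \<le> dist (y - w) (a + b)"
        using infdist_le subspace_add[OF X] a(1) b(1) by blast
      also have "\<dots> \<le> dist (y - z) a + dist (z - w) b"
        using norm_triangle_ineq[of "y - z - a" "z - w - b"] by (simp add: dist_norm algebra_simps)
      also have "\<dots> \<le> r" using a(2) b(2) unfolding e_def by argo
      finally show ?thesis .
    qed
    then show ?thesis unfolding yz inf by (rule dense_ge)
  qed
qed

definition separable_quotient :: "'y::real_normed_vector set \<Rightarrow> bool" where
  "separable_quotient X \<longleftrightarrow> separable_space (Metric_space.mtopology (cosets X) setdist)"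

section \<open>The space of null sequences in a normed space\<close>

typedef (overloaded) 'a c0 = "{z :: nat \<Rightarrow> 'a::real_normed_vector. (\<lambda>j. norm (z j)) \<longlonglongrightarrow> 0}"
  morphisms c0_nth Abs_c0
  by (rule exI[of _ "\<lambda>_. 0"]) simp

setup_lifting type_definition_c0

lemma c0_nth_norm_LIMSEQ: "(\<lambda>j. norm (c0_nth z j)) \<longlonglongrightarrow> 0"
  using c0_nth by blast

lemma c0_nth_bdd_above: "bdd_above (range (\<lambda>j. norm (c0_nth z j)))"
  by (intro bounded_imp_bdd_above convergent_imp_bounded[OF c0_nth_norm_LIMSEQ])

lemma c0_eqI: "(\<And>j. c0_nth z j = c0_nth w j) \<Longrightarrow> z = w"
  by transfer auto

instantiation c0 :: (real_normed_vector) real_normed_vector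
begin

lift_definition zero_c0 :: "'a c0" is "\<lambda>_. 0" by simp

lift_definition plus_c0 :: "'a c0 \<Rightarrow> 'a c0 \<Rightarrow> 'a c0" is "\<lambda>z w j. z j + w j"
  unfolding tendsto_norm_zero_iff by (rule tendsto_add_zero)

lift_definition minus_c0 :: "'a c0 \<Rightarrow> 'a c0 \<Rightarrow> 'a c0" is "\<lambda>z w j. z j - w j"
  unfolding tendsto_norm_zero_iff using tendsto_diff[of _ 0 _ _ 0] by simp

lift_definition uminus_c0 :: "'a c0 \<Rightarrow> 'a c0" is "\<lambda>z j. - z j" by simp

lift_definition scaleR_c0 :: "real \<Rightarrow> 'a c0 \<Rightarrow> 'a c0" is "\<lambda>r z j. r *\<^sub>R z j"
  unfolding tendsto_norm_zero_iff by (rule tendsto_scaleR[OF tendsto_const, of _ 0, simplified])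

lift_definition norm_c0 :: "'a c0 \<Rightarrow> real" is "\<lambda>z. SUP j. norm (z j)" .

definition dist_c0 :: "'a c0 \<Rightarrow> 'a c0 \<Rightarrow> real" where "dist_c0 z w = norm (z - w)"

definition sgn_c0 :: "'a c0 \<Rightarrow> 'a c0" where "sgn_c0 z = inverse (norm z) *\<^sub>R z"

definition uniformity_c0 :: "('a c0 \<times> 'a c0) filter" where
  "uniformity_c0 = (INF e\<in>{0 <..}. principal {(x, y). dist x y < e})"

definition open_c0 :: "'a c0 set \<Rightarrow> bool" where
  "open_c0 S \<longleftrightarrow> (\<forall>x\<in>S. \<forall>\<^sub>F (x', y) in uniformity. x' = x \<longrightarrow> y \<in> S)"

lemma norm_c0_nth_le: "norm (c0_nth z j) \<le> norm z"
  unfolding norm_c0.rep_eq by (rule cSUP_upper[OF _ c0_nth_bdd_above]) simp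

lemma norm_c0_le: "(\<And>j. norm (c0_nth z j) \<le> r) \<Longrightarrow> norm z \<le> r"
  unfolding norm_c0.rep_eq by (rule cSUP_least) auto

instance
proof
  fix x y z :: "'a c0" and a b :: real
  show "x + y + z = x + (y + z)" by transfer (simp add: add.assoc)
  show "x + y = y + x" by transfer (simp add: add.commute)
  show "0 + x = x" by transfer simp
  show "- x + x = 0" by transfer simp
  show "x - y = x + - y" by transfer simp
  show "a *\<^sub>R (x + y) = a *\<^sub>R x + a *\<^sub>R y" by transfer (simp add: scaleR_add_right)
  show "(a + b) *\<^sub>R x = a *\<^sub>R x + b *\<^sub>R x" by transfer (simp add: scaleR_add_left)
  show "a *\<^sub>R b *\<^sub>R x = (a * b) *\<^sub>R x" by transfer simp
  show "1 *\<^sub>R x = x" by transfer simp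
  show "dist x y = norm (x - y)" by (rule dist_c0_def)
  show "sgn x = inverse (norm x) *\<^sub>R x" by (rule sgn_c0_def)
  show "uniformity = (INF e\<in>{0 <..}. principal {(x :: 'a c0, y). dist x y < e})"
    by (rule uniformity_c0_def)
  show "open U \<longleftrightarrow> (\<forall>x\<in>U. \<forall>\<^sub>F (x', y) in uniformity. x' = x \<longrightarrow> y \<in> U)" for U :: "'a c0 set"
    by (rule open_c0_def)
  show "norm x = 0 \<longleftrightarrow> x = 0"
  proof
    assume "norm x = 0"
    then show "x = 0"
      using norm_c0_nth_le[of x] by (intro c0_eqI) (simp add: zero_c0.rep_eq)
  next
    assume "x = 0"
    then show "norm x = 0" by (simp add: norm_c0.rep_eq zero_c0.rep_eq)
  qed
  show "norm (x + y) \<le> norm x + norm y"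
  proof (rule norm_c0_le)
    fix j
    show "norm (c0_nth (x + y) j) \<le> norm x + norm y"
      using norm_triangle_ineq[of "c0_nth x j" "c0_nth y j"] norm_c0_nth_le[of x j] norm_c0_nth_le[of y j]
      by (simp add: plus_c0.rep_eq)
  qed
  have le: "norm (c *\<^sub>R w) \<le> \<bar>c\<bar> * norm w" for c :: real and w :: "'a c0"
    by (rule norm_c0_le) (simp add: scaleR_c0.rep_eq mult_left_mono norm_c0_nth_le)
  show "norm (a *\<^sub>R x) = \<bar>a\<bar> * norm x"
  proof (cases "a = 0")
    case True
    have "norm (a *\<^sub>R x) \<ge> 0"
      using norm_c0_nth_le[of "a *\<^sub>R x" 0] norm_ge_zero order_trans by blast
    then show ?thesis using le[of a x] True by simp
  next
    case False
    have "inverse a *\<^sub>R (a *\<^sub>R x) = x" using False by transfer simp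
    then have "norm x \<le> \<bar>inverse a\<bar> * norm (a *\<^sub>R x)" using le[of "inverse a" "a *\<^sub>R x"] by simp
    then have "\<bar>a\<bar> * norm x \<le> norm (a *\<^sub>R x)" using False by (simp add: field_simps)
    then show ?thesis using le[of a x] by simp
  qed
qed

end

instance c0 :: (banach) banach
proof
  fix Z :: "nat \<Rightarrow> 'a c0"
  assume C: "Cauchy Z"
  have "Cauchy (\<lambda>n. c0_nth (Z n) j)" for j
  proof (rule CauchyI)
    fix e :: real assume "e > 0"
    then obtain M where M: "\<And>m n. m \<ge> M \<Longrightarrow> n \<ge> M \<Longrightarrow> norm (Z m - Z n) < e"
      using CauchyD[OF C] by blast
    have "norm (c0_nth (Z m) j - c0_nth (Z n) j) < e" if "m \<ge> M" "n \<ge> M" for m n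
      using norm_c0_nth_le[of "Z m - Z n" j] M[OF that] by (simp add: minus_c0.rep_eq)
    then show "\<exists>M. \<forall>m\<ge>M. \<forall>n\<ge>M. norm (c0_nth (Z m) j - c0_nth (Z n) j) < e" by blast
  qed
  then have "\<forall>j. \<exists>l. (\<lambda>n. c0_nth (Z n) j) \<longlonglongrightarrow> l"
    by (simp add: Cauchy_convergent convergentD)
  then obtain w where w: "\<And>j. (\<lambda>n. c0_nth (Z n) j) \<longlonglongrightarrow> w j"
    by metis
  have unif: "\<exists>M. \<forall>n\<ge>M. \<forall>j. norm (c0_nth (Z n) j - w j) \<le> e" if "e > 0" for e
  proof -
    obtain M where M: "\<And>m n. m \<ge> M \<Longrightarrow> n \<ge> M \<Longrightarrow> norm (Z m - Z n) < e"
      using CauchyD[OF C \<open>e > 0\<close>] by blast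
    have "norm (c0_nth (Z n) j - w j) \<le> e" if n: "n \<ge> M" for n j
    proof (rule LIMSEQ_le_const2)
      show "(\<lambda>m. norm (c0_nth (Z n) j - c0_nth (Z m) j)) \<longlonglongrightarrow> norm (c0_nth (Z n) j - w j)"
        by (intro tendsto_norm tendsto_diff tendsto_const w)
      have "norm (c0_nth (Z n) j - c0_nth (Z m) j) \<le> e" if "m \<ge> M" for m
        using norm_c0_nth_le[of "Z n - Z m" j] M[OF n that] by (simp add: minus_c0.rep_eq)
      then show "\<exists>N. \<forall>m\<ge>N. norm (c0_nth (Z n) j - c0_nth (Z m) j) \<le> e" by blast
    qed
    then show ?thesis by blast
  qed
  have w0: "(\<lambda>j. norm (w j)) \<longlonglongrightarrow> 0"
  proof (rule LIMSEQ_I)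
    fix e :: real assume e: "e > 0"
    obtain M where M: "\<And>n j. n \<ge> M \<Longrightarrow> norm (c0_nth (Z n) j - w j) \<le> e/2"
      using unif[of "e/2"] e by auto
    obtain N where N: "\<And>j. j \<ge> N \<Longrightarrow> norm (c0_nth (Z M) j) < e/2"
      using LIMSEQ_D[OF c0_nth_norm_LIMSEQ[of "Z M"], of "e/2"] e by auto
    have "norm (w j) < e" if "j \<ge> N" for j
      using norm_triangle_ineq4[of "c0_nth (Z M) j" "c0_nth (Z M) j - w j"] M[of M j] N[OF that]
      by simp
    then show "\<exists>N. \<forall>j\<ge>N. norm (norm (w j) - 0) < e" by auto
  qed
  have nth: "c0_nth (Abs_c0 w) = w" using w0 by (simp add: Abs_c0_inverse)
  have "Z \<longlonglongrightarrow> Abs_c0 w"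
  proof (rule LIMSEQ_I)
    fix e :: real assume e: "e > 0"
    obtain M where M: "\<And>n j. n \<ge> M \<Longrightarrow> norm (c0_nth (Z n) j - w j) \<le> e/2"
      using unif[of "e/2"] e by auto
    have "norm (Z n - Abs_c0 w) < e" if "n \<ge> M" for n
    proof -
      have "norm (Z n - Abs_c0 w) \<le> e/2"
        by (rule norm_c0_le) (use M[OF that] in \<open>simp add: minus_c0.rep_eq nth\<close>)
      then show ?thesis using e by simp
    qed
    then show "\<exists>M. \<forall>n\<ge>M. norm (Z n - Abs_c0 w) < e" by blast
  qed
  then show "convergent Z" by (rule convergentI)
qed

section \<open>The space of null sequences of bounded scalar sequences\<close>

text \<open>The library has this instance only for metric domains, and \<open>nat\<close> is not in class \<open>metric_space\<close>.\<close>

instance bcontfun :: (topological_space, complete_space) complete_space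
proof
  fix f :: "nat \<Rightarrow> 'a \<Rightarrow>\<^sub>C 'b"
  assume "Cauchy f"
  then have "\<exists>N. \<forall>m n x. N \<le> m \<and> N \<le> n \<and> True \<longrightarrow> dist (f m x) (f n x) < e" if "e > 0" for e
  proof -
    obtain N where "\<And>m n. N \<le> m \<Longrightarrow> N \<le> n \<Longrightarrow> dist (f m) (f n) < e"
      using \<open>Cauchy f\<close> \<open>e > 0\<close> unfolding Cauchy_def by blast
    then show ?thesis
      by (intro exI[of _ N]) (simp add: dist_fun_lt_imp_dist_val_lt)
  qed
  then obtain g where g: "\<forall>e>0. \<exists>N. \<forall>n x. N \<le> n \<and> True \<longrightarrow> dist (f n x) (g x) < e"
    using uniformly_convergent_eq_cauchy[of "\<lambda>_. True" f] by blast
  then have "uniform_limit UNIV f g sequentially"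
    unfolding uniform_limit_sequentially_iff by simp
  then obtain l where "f \<longlonglongrightarrow> l"
    by (rule uniform_limit_bcontfunE[OF _ sequentially_bot])
  then show "convergent f"
    by (rule convergentI)
qed

instance bcontfun :: (topological_space, banach) banach ..

text \<open>As \<open>nat\<close> is discrete, the bounded continuous functions on it are all bounded sequences.\<close>

type_synonym 'k linfty = "nat \<Rightarrow>\<^sub>C 'k"

setup_lifting type_definition_bcontfun

lift_definition linfty_scale :: "'k::real_normed_field \<Rightarrow> 'k linfty \<Rightarrow> 'k linfty"
  is "\<lambda>a f n. a * f n"
proof -
  fix a :: 'k and f :: "nat \<Rightarrow> 'k"
  assume "f \<in> bcontfun"
  then have "bounded (range f)" by (simp add: bcontfun_def)
  then have "bounded (range (\<lambda>n. a * f n))"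
    using bounded_linear_image[OF _ bounded_linear_mult_right, of "range f" a]
    by (simp add: image_image)
  then show "(\<lambda>n. a * f n) \<in> bcontfun" by (simp add: bcontfun_def)
qed

lemma norm_linfty_eq: "norm (f :: 'k::real_normed_field linfty) = (SUP n. norm (f n))"
proof -
  have "norm f = dist f 0" by simp
  also have "\<dots> = (SUP n. dist (f n) ((0 :: 'k linfty) n))" by (rule dist_bcontfun.rep_eq)
  finally show ?thesis by (simp add: zero_bcontfun.rep_eq)
qed

lemma norm_linfty_scale_le: "norm (linfty_scale a f) \<le> norm a * norm f"
  by (rule norm_bound) (simp add: linfty_scale.rep_eq norm_mult mult_left_mono norm_bounded)

lift_definition c0_linfty_scale :: "'k::real_normed_field \<Rightarrow> 'k linfty c0 \<Rightarrow> 'k linfty c0"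
  is "\<lambda>a z j. linfty_scale a (z j)"
proof -
  fix a :: 'k and z :: "nat \<Rightarrow> 'k linfty"
  assume "(\<lambda>j. norm (z j)) \<longlonglongrightarrow> 0"
  then show "(\<lambda>j. norm (linfty_scale a (z j))) \<longlonglongrightarrow> 0"
    by (rule tendsto_0_le[where K = "norm a"])
      (simp add: norm_linfty_scale_le mult.commute[of _ "norm a"])
qed

lemma banach_scaling_c0_linfty:
  "banach_scaling (c0_linfty_scale :: 'k::{real_normed_field,banach} \<Rightarrow> 'k linfty c0 \<Rightarrow> 'k linfty c0)"
proof -
  note rep = c0_linfty_scale.rep_eq linfty_scale.rep_eq plus_c0.rep_eq plus_bcontfun.rep_eq
    scaleR_c0.rep_eq scaleR_bcontfun.rep_eq
  have vs: "vector_space (c0_linfty_scale :: 'k \<Rightarrow> 'k linfty c0 \<Rightarrow> _)"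
    by unfold_locales (auto intro!: c0_eqI bcontfun_eqI simp: rep algebra_simps)
  have le: "norm (c0_linfty_scale a z) \<le> norm a * norm z" for a :: 'k and z
  proof (rule norm_c0_le)
    fix j
    have "norm (c0_nth (c0_linfty_scale a z) j) \<le> norm a * norm (c0_nth z j)"
      by (simp add: c0_linfty_scale.rep_eq norm_linfty_scale_le)
    also have "\<dots> \<le> norm a * norm z"
      by (simp add: mult_left_mono norm_c0_nth_le)
    finally show "norm (c0_nth (c0_linfty_scale a z) j) \<le> norm a * norm z" .
  qed
  have "norm (c0_linfty_scale a z) = norm a * norm z" for a :: 'k and z
  proof (cases "a = 0")
    case True
    then show ?thesis using le[of a z] by simp
  next
    case False
    have "c0_linfty_scale (inverse a) (c0_linfty_scale a z) = z"
      using False by (intro c0_eqI bcontfun_eqI) (simp add: rep)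
    then have "norm z \<le> norm (inverse a) * norm (c0_linfty_scale a z)"
      using le[of "inverse a" "c0_linfty_scale a z"] by simp
    then have "norm a * norm z \<le> norm (c0_linfty_scale a z)"
      using False by (simp add: norm_inverse norm_divide field_simps)
    then show ?thesis using le[of a z] by simp
  qed
  moreover have "c0_linfty_scale (of_real r :: 'k) z = r *\<^sub>R z" for r z
    by (intro c0_eqI bcontfun_eqI) (simp add: rep scaleR_conv_of_real)
  ultimately show ?thesis using vs by (simp add: banach_scaling_def)
qed

end

theory Submission
  imports Defs "HOL-Complex_Analysis.Great_Picard"
begin

text \<open>
  Let \<open>X\<close> be a closed subspace of \<open>Y\<close> with separable quotient \<open>Y/X\<close>. Both halves of the theorem follow
  from one fact: every operator \<open>T\<close> from \<open>X\<close> to \<open>c\<^sub>0(\<ell>\<^sup>\<infinity>)\<close> has an extension to \<open>Y\<close> of norm at most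
  \<open>2 \<parallel>T\<parallel>\<close>, see \<open>c0_linfty_extension\<close>. If \<open>Y\<close> itself is separable this is the extension property; if
  \<open>X\<close> is an isometric copy of \<open>c\<^sub>0(\<ell>\<^sup>\<infinity>)\<close> and \<open>T\<close> is the inverse of the embedding, the extension followed
  by the embedding is the projection.

  The idea is Veech's proof of Sobczyk's theorem. An operator into \<open>c\<^sub>0(\<ell>\<^sup>\<infinity>)\<close> is a doubly indexed family
  of functionals \<open>f\<^sub>j\<^sub>n\<close>, bounded by \<open>C = \<parallel>T\<parallel>\<close>, that tends to \<open>0\<close> pointwise as \<open>j\<close> grows, uniformly
  in \<open>n\<close>. The Hahn-Banach theorem extends each \<open>f\<^sub>j\<^sub>n\<close> to \<open>F\<^sub>j\<^sub>n\<close> on \<open>Y\<close> with the same bound, but the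
  extended family need not tend to \<open>0\<close>. Its limit points are harmless, however: a
  pointwise limit of functionals \<open>F\<^sub>j\<^sub>n\<close> with \<open>j\<close> tending to infinity vanishes on \<open>X\<close> and is again
  bounded by \<open>C\<close>. By compactness there are therefore functionals \<open>h\<^sub>j\<^sub>n\<close> that vanish on \<open>X\<close>, are bounded by
  \<open>C\<close> and are asymptotically equal to the \<open>F\<^sub>j\<^sub>n\<close>, uniformly in \<open>n\<close> (\<open>annihilator_asymptotic\<close>). The
  differences \<open>F\<^sub>j\<^sub>n - h\<^sub>j\<^sub>n\<close> still extend \<open>f\<^sub>j\<^sub>n\<close>, are bounded by \<open>2 C\<close>, and tend to \<open>0\<close>
  (\<open>uniformly_null_extension\<close>).

  The compactness needed is only sequential, because functionals that tend to \<open>0\<close> on \<open>X\<close> and are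
  uniformly bounded are controlled by their values on a sequence that is dense modulo \<open>X\<close>
  (\<open>functionals_convergent_subsequence\<close>). This is where the separability of \<open>Y/X\<close> enters.
\<close>

section \<open>Norm-preserving extension of functionals\<close>

text \<open>
  Zorn's lemma is applied to the graphs of dominated linear extensions of \<open>f\<close>, as subspaces of
  \<open>'y \<times> real\<close>. The one-sided bound \<open>r \<le> C * norm x\<close> on such a subspace already forces it to be the
  graph of a function, since it makes the second component of \<open>(0, r)\<close> and of \<open>(0, - r)\<close> nonpositive. So
  neither functionality nor a domain has to be carried along.
\<close>

lemma hahn_banach_real_linear:
  fixes f :: "'y::real_normed_vector \<Rightarrow> real"
  assumes X: "subspace X" and C: "0 \<le> C"
    and add: "\<And>x y. x \<in> X \<Longrightarrow> y \<in> X \<Longrightarrow> f (x + y) = f x + f y"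
    and scale: "\<And>a x. x \<in> X \<Longrightarrow> f (a *\<^sub>R x) = a * f x"
    and bound: "\<And>x. x \<in> X \<Longrightarrow> \<bar>f x\<bar> \<le> C * norm x"
  shows "\<exists>g. linear g \<and> (\<forall>y. \<bar>g y\<bar> \<le> C * norm y) \<and> (\<forall>x\<in>X. g x = f x)"
proof -
  define \<A> where "\<A> = {G :: ('y \<times> real) set. subspace G \<and>
    (\<forall>x r. (x, r) \<in> G \<longrightarrow> r \<le> C * norm x) \<and> (\<forall>x\<in>X. (x, f x) \<in> G)}"
  have f0: "f 0 = 0" using scale[of 0 0] subspace_0[OF X] by simp
  have "(\<lambda>x. (x, f x)) ` X \<in> \<A>"
  proof -
    have "subspace ((\<lambda>x. (x, f x)) ` X)"
      unfolding subspace_def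
    proof (intro conjI ballI allI)
      show "0 \<in> (\<lambda>x. (x, f x)) ` X"
        using subspace_0[OF X] f0 by (force simp: zero_prod_def)
    next
      fix u v assume "u \<in> (\<lambda>x. (x, f x)) ` X" "v \<in> (\<lambda>x. (x, f x)) ` X"
      then show "u + v \<in> (\<lambda>x. (x, f x)) ` X"
        using subspace_add[OF X] add by force
    next
      fix c :: real and u assume "u \<in> (\<lambda>x. (x, f x)) ` X"
      then show "c *\<^sub>R u \<in> (\<lambda>x. (x, f x)) ` X"
        using subspace_scale[OF X, of _ c] scale by force
    qed
    then show ?thesis
      unfolding \<A>_def using bound by (auto simp: abs_le_iff)
  qed
  then have ne: "\<A> \<noteq> {}" by blast
  have "\<Union>\<C> \<in> \<A>" if "\<C> \<noteq> {}" and chain: "subset.chain \<A> \<C>" for \<C>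
  proof -
    have sub: "\<C> \<subseteq> \<A>" and tot: "\<And>G H. G \<in> \<C> \<Longrightarrow> H \<in> \<C> \<Longrightarrow> G \<subseteq> H \<or> H \<subseteq> G"
      using chain by (auto simp: subset_chain_def)
    have ss: "subspace G" if "G \<in> \<C>" for G using that sub by (auto simp: \<A>_def)
    have "subspace (\<Union>\<C>)"
      unfolding subspace_def
    proof (intro conjI ballI allI)
      show "0 \<in> \<Union>\<C>" using \<open>\<C> \<noteq> {}\<close> ss subspace_0 by blast
    next
      fix u v assume "u \<in> \<Union>\<C>" "v \<in> \<Union>\<C>"
      then obtain G H where "G \<in> \<C>" "H \<in> \<C>" "u \<in> G" "v \<in> H" by blast
      then show "u + v \<in> \<Union>\<C>" using tot[of G H] ss subspace_add by blast
    next
      fix c :: real and u assume "u \<in> \<Union>\<C>"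
      then show "c *\<^sub>R u \<in> \<Union>\<C>" using ss subspace_scale by blast
    qed
    then show ?thesis using sub \<open>\<C> \<noteq> {}\<close> unfolding \<A>_def by blast
  qed
  then obtain G where G: "G \<in> \<A>" and max: "\<And>H. H \<in> \<A> \<Longrightarrow> G \<subseteq> H \<Longrightarrow> H = G"
    using subset_Zorn_nonempty[OF ne] by blast
  have sG: "subspace G" and bG: "\<And>x r. (x, r) \<in> G \<Longrightarrow> r \<le> C * norm x"
    and fG: "\<And>x. x \<in> X \<Longrightarrow> (x, f x) \<in> G"
    using G by (auto simp: \<A>_def)
  have uniq: "r = q" if "(x, r) \<in> G" "(x, q) \<in> G" for x r q
    using bG[of 0 "r - q"] bG[of 0 "q - r"] subspace_diff[OF sG that] subspace_diff[OF sG that(2,1)]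
    by simp
  have dom: "\<exists>r. (y, r) \<in> G" for y
  proof -
    \<comment> \<open>\<open>a\<close> is a value at \<open>y\<close> compatible with the bound at all points \<open>x + y\<close> and \<open>x - y\<close>;
      homogeneity then gives the bound at every \<open>x + t y\<close>, so maximality puts \<open>(y, a)\<close> into \<open>G\<close>\<close>
    define S where "S = {r - C * norm (x - y) | x r. (x, r) \<in> G}"
    define a where "a = Sup S"
    have cross: "r - C * norm (x - y) \<le> C * norm (x' + y) - r'" if "(x, r) \<in> G" "(x', r') \<in> G" for x r x' r'
    proof -
      have "r + r' \<le> C * norm (x + x')"
        using bG subspace_add[OF sG that] by simp
      also have "\<dots> \<le> C * (norm (x - y) + norm (x' + y))"
        using norm_triangle_ineq[of "x - y" "x' + y"] C by (intro mult_left_mono) auto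
      finally show ?thesis by (simp add: algebra_simps)
    qed
    have G0: "(0, 0) \<in> G" using subspace_0[OF sG] by (simp add: zero_prod_def)
    have "bdd_above S"
      unfolding S_def by (rule bdd_aboveI[of _ "C * norm (0 + y) - 0"]) (use cross G0 in blast)
    then have lo: "r - C * norm (x - y) \<le> a" if "(x, r) \<in> G" for x r
      unfolding a_def by (intro cSup_upper) (use that in \<open>auto simp: S_def\<close>)
    have "S \<noteq> {}" using G0 by (auto simp: S_def)
    then have hi: "a \<le> C * norm (x + y) - r" if "(x, r) \<in> G" for x r
      unfolding a_def by (rule cSup_least) (use that cross in \<open>auto simp: S_def\<close>)
    define H where "H = span (insert (y, a) G)"
    have "H \<in> \<A>"
    proof -
      have "q \<le> C * norm v" if "(v, q) \<in> H" for v q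
      proof -
        obtain t where "(v, q) - t *\<^sub>R (y, a) \<in> span G"
          using \<open>(v, q) \<in> H\<close> unfolding H_def span_breakdown_eq by blast
        moreover have "span G = G" using sG by (rule span_eq_iff[THEN iffD2])
        ultimately have vq: "(v - t *\<^sub>R y, q - t * a) \<in> G" by simp
        have scaled: "(c *\<^sub>R (v - t *\<^sub>R y), c * (q - t * a)) \<in> G" for c
          using subspace_scale[OF sG vq, of c] by simp
        consider "t = 0" | "t > 0" | "t < 0" by linarith
        then show ?thesis
        proof cases
          case 1
          then show ?thesis using bG[OF vq] by simp
        next
          case 2
          have "a \<le> C * norm ((1/t) *\<^sub>R v) - (1/t) * (q - t * a)"
            using hi[OF scaled[of "1/t"]] 2 by (simp add: scaleR_diff_right)
          then show ?thesis using 2 by (simp add: field_simps)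
        next
          case 3
          have "(- 1/t) * (q - t * a) - C * norm ((- 1/t) *\<^sub>R v) \<le> a"
            using lo[OF scaled[of "-1/t"]] 3 by (simp add: scaleR_diff_right)
          then show ?thesis using 3 by (simp add: field_simps)
        qed
      qed
      moreover have "G \<subseteq> H" unfolding H_def using span_superset by blast
      ultimately show ?thesis using fG unfolding \<A>_def by (auto simp: H_def)
    qed
    moreover have "insert (y, a) G \<subseteq> H" unfolding H_def by (rule span_superset)
    ultimately show ?thesis using max[of H] by blast
  qed
  define g where "g y = (THE r. (y, r) \<in> G)" for y
  have gG: "(y, g y) \<in> G" for y
    unfolding g_def using dom uniq by (metis theI)
  have g_eq: "g y = r" if "(y, r) \<in> G" for y r
    using uniq[OF gG that] .
  have "linear g"
  proof (rule linearI)
    show "g (x + y) = g x + g y" for x y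
      using subspace_add[OF sG gG[of x] gG[of y]] by (intro g_eq) simp
    show "g (c *\<^sub>R x) = c *\<^sub>R g x" for c x
      using subspace_scale[OF sG gG[of x], of c] by (intro g_eq) simp
  qed
  moreover have "\<bar>g y\<bar> \<le> C * norm y" for y
    using bG[OF gG[of y]] bG[OF gG[of "- y"]] linear_neg[OF \<open>linear g\<close>, of y] by simp
  moreover have "g x = f x" if "x \<in> X" for x
    using fG[OF that] by (rule g_eq)
  ultimately show ?thesis by blast
qed

definition bounded_functional_on ::
  "('k::real_normed_field \<Rightarrow> 'y::banach \<Rightarrow> 'y) \<Rightarrow> 'y set \<Rightarrow> real \<Rightarrow> ('y \<Rightarrow> 'k) \<Rightarrow> bool" where
  "bounded_functional_on s X C f \<longleftrightarrow>
     (\<forall>x\<in>X. \<forall>y\<in>X. f (x + y) = f x + f y) \<and> (\<forall>a. \<forall>x\<in>X. f (s a x) = a * f x) \<and>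
     (\<forall>x\<in>X. norm (f x) \<le> C * norm x)"

text \<open>
  The scalar field enters the whole argument only through the extension theorem for functionals.
  Isolating that as a property of the scalar multiplication lets the rest be done once for real and
  complex scalars.
\<close>

definition hahn_banach_property :: "('k::real_normed_field \<Rightarrow> 'y::banach \<Rightarrow> 'y) \<Rightarrow> bool" where
  "hahn_banach_property s \<longleftrightarrow>
     (\<forall>X C f. module.subspace s X \<and> 0 \<le> C \<and> bounded_functional_on s X C f \<longrightarrow>
        (\<exists>g. bounded_functional_on s UNIV C g \<and> (\<forall>x\<in>X. g x = f x)))"

lemma banach_scaling_module: "banach_scaling s \<Longrightarrow> module s"
  by (simp add: banach_scaling_def vector_space_def module_def)

lemma banach_scaling_of_real: "banach_scaling s \<Longrightarrow> s (of_real r) v = r *\<^sub>R v"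
  by (simp add: banach_scaling_def)

lemma banach_scaling_norm: "banach_scaling s \<Longrightarrow> norm (s a v) = norm a * norm v"
  by (simp add: banach_scaling_def)

lemma subspace_if_scaling_subspace:
  assumes s: "banach_scaling s" and X: "module.subspace s X"
  shows "subspace X"
proof -
  note X' = X[unfolded module.subspace_def[OF banach_scaling_module[OF s]]]
  show ?thesis
    unfolding subspace_def
  proof (intro conjI ballI allI)
    fix c :: real and x assume "x \<in> X"
    then have "s (of_real c) x \<in> X" using X' by blast
    then show "c *\<^sub>R x \<in> X" by (simp add: banach_scaling_of_real[OF s])
  qed (use X' in auto)
qed

lemma hahn_banach_property_real:
  fixes s :: "real \<Rightarrow> 'y::banach \<Rightarrow> 'y"
  assumes s: "banach_scaling s"
  shows "hahn_banach_property s"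
  unfolding hahn_banach_property_def
proof (intro allI impI, elim conjE)
  fix X C f assume X: "module.subspace s X" and C: "0 \<le> C" and f: "bounded_functional_on s X C f"
  have s_eq: "s = scaleR" using s banach_scaling_real by blast
  obtain g where g: "linear g" "\<And>y. \<bar>g y\<bar> \<le> C * norm y" "\<And>x. x \<in> X \<Longrightarrow> g x = f x"
    using hahn_banach_real_linear[OF subspace_if_scaling_subspace[OF s X] C, of f] f
    by (auto simp: bounded_functional_on_def s_eq)
  then have "bounded_functional_on s UNIV C g"
    by (simp add: bounded_functional_on_def s_eq linear_add linear_scale)
  with g show "\<exists>g. bounded_functional_on s UNIV C g \<and> (\<forall>x\<in>X. g x = f x)" by blast
qed

text \<open>
  A complex functional is determined by its real part \<open>u\<close>, namely as \<open>u y - \<i> u (\<i> y)\<close>, so it is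
  enough to extend the real part.
\<close>

lemma hahn_banach_property_complex:
  fixes s :: "complex \<Rightarrow> 'y::banach \<Rightarrow> 'y"
  assumes s: "banach_scaling s"
  shows "hahn_banach_property s"
  unfolding hahn_banach_property_def
proof (intro allI impI, elim conjE)
  fix X C f assume X: "module.subspace s X" and C: "0 \<le> C" and f: "bounded_functional_on s X C f"
  interpret s: module s using s by (rule banach_scaling_module)
  have add: "\<And>x y. x \<in> X \<Longrightarrow> y \<in> X \<Longrightarrow> f (x + y) = f x + f y"
    and scale: "\<And>a x. x \<in> X \<Longrightarrow> f (s a x) = a * f x"
    and bound: "\<And>x. x \<in> X \<Longrightarrow> norm (f x) \<le> C * norm x"
    using f by (auto simp: bounded_functional_on_def)
  have "Re (f (a *\<^sub>R x)) = a * Re (f x)" if "x \<in> X" for a x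
    using scale[OF that, of "of_real a"] by (simp add: banach_scaling_of_real[OF s])
  moreover have "\<bar>Re (f x)\<bar> \<le> C * norm x" if "x \<in> X" for x
    using abs_Re_le_cmod[of "f x"] bound[OF that] by linarith
  ultimately obtain u where u: "linear u" and bu: "\<And>y. \<bar>u y\<bar> \<le> C * norm y"
    and ext: "\<And>x. x \<in> X \<Longrightarrow> u x = Re (f x)"
    using hahn_banach_real_linear[OF subspace_if_scaling_subspace[OF s X] C, of "\<lambda>x. Re (f x)"] add
    by auto
  define g where "g y = Complex (u y) (- u (s \<i> y))" for y
  have s_split: "s a y = Re a *\<^sub>R y + Im a *\<^sub>R s \<i> y" for a y
  proof -
    have "s a y = s (of_real (Re a) + of_real (Im a) * \<i>) y"
      by (simp add: complex_eq[symmetric] mult.commute)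
    then show ?thesis
      by (simp add: s.scale_left_distrib s.scale_scale[symmetric] banach_scaling_of_real[OF s]
          del: s.scale_scale)
  qed
  have g_add: "g (x + y) = g x + g y" for x y
    by (simp add: g_def complex_eq_iff s.scale_right_distrib linear_add[OF u])
  have g_scale: "g (s a y) = a * g y" for a y
  proof -
    have "u (s a y) = Re a * u y + Im a * u (s \<i> y)" for a y
      by (subst s_split) (simp add: linear_add[OF u] linear_scale[OF u])
    from this[of a y] this[of "\<i> * a" y] show ?thesis
      by (simp add: g_def complex_eq_iff)
  qed
  have "norm (g y) \<le> C * norm y" for y
  proof (cases "g y = 0")
    case True
    then show ?thesis using C by simp
  next
    case False
    \<comment> \<open>rotate \<open>y\<close> so that \<open>g\<close> becomes real and positive there\<close>
    define \<theta> where "\<theta> = of_real (norm (g y)) / g y"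
    have "norm \<theta> = 1" using False by (simp add: \<theta>_def norm_divide)
    have "g (s \<theta> y) = of_real (norm (g y))" using False by (simp add: g_scale \<theta>_def)
    then have "norm (g y) = u (s \<theta> y)" by (simp add: g_def complex_eq_iff)
    also have "\<dots> \<le> C * norm (s \<theta> y)" using bu[of "s \<theta> y"] by linarith
    finally show ?thesis using \<open>norm \<theta> = 1\<close> by (simp add: banach_scaling_norm[OF s])
  qed
  moreover have "g x = f x" if "x \<in> X" for x
    using that ext[of x] ext[of "s \<i> x"] scale[of x \<i>] s.subspace_scale[OF X, of x \<i>]
    by (simp add: g_def complex_eq_iff)
  ultimately show "\<exists>g. bounded_functional_on s UNIV C g \<and> (\<forall>x\<in>X. g x = f x)"
    using g_add g_scale by (auto simp: bounded_functional_on_def)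
qed

section \<open>Pointwise limits of functionals\<close>

definition dense_modulo :: "(nat \<Rightarrow> 'y::real_normed_vector) \<Rightarrow> 'y set \<Rightarrow> bool" where
  "dense_modulo d X \<longleftrightarrow> (\<forall>y. \<forall>e>0. \<exists>i. \<exists>x\<in>X. norm (y - d i - x) < e)"

lemma bounded_functional_on_diff:
  assumes "bounded_functional_on s UNIV C f"
  shows "f (x - y) = f x - f y"
proof -
  have "f (x - y + y) = f (x - y) + f y"
    using assms unfolding bounded_functional_on_def by blast
  then show ?thesis by simp
qed

lemma bounded_functional_on_bound:
  "bounded_functional_on s UNIV C f \<Longrightarrow> norm (f x) \<le> C * norm x"
  by (simp add: bounded_functional_on_def)

lemma bounded_functional_on_le_near:
  assumes f: "bounded_functional_on s UNIV C f" and C: "0 \<le> C"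
    and near: "norm (y - z - x) \<le> r"
  shows "norm (f y) \<le> C * r + norm (f z) + norm (f x)"
proof -
  have "norm (f y) = norm (f (y - z - x) + f z + f x)"
    by (simp add: bounded_functional_on_diff[OF f])
  also have "\<dots> \<le> norm (f (y - z - x)) + norm (f z) + norm (f x)"
    by (meson norm_add_rule_thm norm_triangle_ineq order.refl)
  also have "norm (f (y - z - x)) \<le> C * norm (y - z - x)"
    by (rule bounded_functional_on_bound[OF f])
  also have "C * norm (y - z - x) \<le> C * r"
    using near C by (rule mult_left_mono)
  finally show ?thesis by simp
qed

lemma bounded_functional_on_minus:
  assumes f: "bounded_functional_on s UNIV C f" and g: "bounded_functional_on s UNIV D g"
  shows "bounded_functional_on s UNIV (C + D) (\<lambda>y. f y - g y)"
proof -
  have "norm (f y - g y) \<le> (C + D) * norm y" for y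
    using norm_triangle_ineq4[of "f y" "g y"] bounded_functional_on_bound[OF f, of y]
      bounded_functional_on_bound[OF g, of y] by (simp add: algebra_simps)
  then show ?thesis
    using f g by (simp add: bounded_functional_on_def algebra_simps)
qed

text \<open>
  If \<open>y\<close> is close to \<open>d i + x\<close> with \<open>x \<in> X\<close>, then \<open>F m y\<close> is close to \<open>F m (d i) + F m x\<close> uniformly
  in \<open>m\<close>. The sequence \<open>F m y\<close> is therefore Cauchy.
\<close>

lemma functionals_convergent_if_dense_modulo:
  fixes F :: "nat \<Rightarrow> 'y::banach \<Rightarrow> 'k::{real_normed_field, banach}"
  assumes F: "\<And>m. bounded_functional_on s UNIV C (F m)" and C: "0 \<le> C"
    and dense: "dense_modulo d X"
    and null: "\<And>x. x \<in> X \<Longrightarrow> (\<lambda>m. F m x) \<longlonglongrightarrow> 0"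
    and conv: "\<And>i. convergent (\<lambda>m. F m (d i))"
  shows "convergent (\<lambda>m. F m y)"
proof (rule Cauchy_convergent, rule CauchyI)
  fix e :: real assume e: "e > 0"
  define r where "r = e / (3 * (C + C + 1))"
  have r: "r > 0" "(C + C) * r < e / 3" using e C by (auto simp: r_def field_simps)
  obtain i x where x: "x \<in> X" and near: "norm (y - d i - x) < r"
    using dense r(1) unfolding dense_modulo_def by blast
  have "Cauchy (\<lambda>m. F m (d i))" using conv convergent_Cauchy by blast
  then obtain M where M: "\<And>m n. m \<ge> M \<Longrightarrow> n \<ge> M \<Longrightarrow> norm (F m (d i) - F n (d i)) < e/3"
    using CauchyD[of _ "e/3"] e by (metis divide_pos_pos zero_less_numeral)
  have "Cauchy (\<lambda>m. F m x)" using null[OF x] LIMSEQ_imp_Cauchy by blast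
  then obtain N where N: "\<And>m n. m \<ge> N \<Longrightarrow> n \<ge> N \<Longrightarrow> norm (F m x - F n x) < e/3"
    using CauchyD[of _ "e/3"] e by (metis divide_pos_pos zero_less_numeral)
  have "norm (F m y - F n y) < e" if "m \<ge> max M N" "n \<ge> max M N" for m n
  proof -
    have "norm (F m y - F n y)
        \<le> (C + C) * r + norm (F m (d i) - F n (d i)) + norm (F m x - F n x)"
      using bounded_functional_on_le_near[OF bounded_functional_on_minus[OF F[of m] F[of n]]] C near
      by simp
    then show ?thesis using M[of m n] N[of m n] r(2) that by simp
  qed
  then show "\<exists>M. \<forall>m\<ge>M. \<forall>n\<ge>M. norm (F m y - F n y) < e" by blast
qed

lemma bounded_functional_on_pointwise_limit:
  fixes F :: "nat \<Rightarrow> 'y::banach \<Rightarrow> 'k::real_normed_field"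
  assumes F: "\<And>m. bounded_functional_on s UNIV C (F m)" and lim: "\<And>y. (\<lambda>m. F m y) \<longlonglongrightarrow> h y"
  shows "bounded_functional_on s UNIV C h"
  unfolding bounded_functional_on_def
proof (intro conjI ballI allI)
  fix x y
  have "(\<lambda>m. F m (x + y)) \<longlonglongrightarrow> h x + h y"
    using tendsto_add[OF lim[of x] lim[of y]] F by (simp add: bounded_functional_on_def)
  then show "h (x + y) = h x + h y" using lim LIMSEQ_unique by blast
next
  fix a x
  have "(\<lambda>m. F m (s a x)) \<longlonglongrightarrow> a * h x"
    using tendsto_mult_left[OF lim[of x], of a] F by (simp add: bounded_functional_on_def)
  then show "h (s a x) = a * h x" using lim LIMSEQ_unique by blast
next
  fix x
  show "norm (h x) \<le> C * norm x"
    using tendsto_norm[OF lim[of x]] bounded_functional_on_bound[OF F]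
    by (intro LIMSEQ_le_const2) auto
qed

text \<open>
  A sequential Banach-Alaoglu theorem relative to \<open>X\<close>: a diagonal argument makes the functionals
  converge on the sequence \<open>d\<close>, hence everywhere.
\<close>

lemma functionals_convergent_subsequence:
  fixes F :: "nat \<Rightarrow> 'y::banach \<Rightarrow> 'k::{real_normed_field, euclidean_space}"
  assumes F: "\<And>m. bounded_functional_on s UNIV C (F m)" and C: "0 \<le> C"
    and dense: "dense_modulo d X"
    and null: "\<And>x. x \<in> X \<Longrightarrow> (\<lambda>m. F m x) \<longlonglongrightarrow> 0"
  shows "\<exists>k h. strict_mono (k :: nat \<Rightarrow> nat) \<and> bounded_functional_on s UNIV C h \<and>
           (\<forall>x\<in>X. h x = 0) \<and> (\<forall>y. (\<lambda>m. F (k m) y) \<longlonglongrightarrow> h y)"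
proof -
  \<comment> \<open>the diagonal argument needs one bound for all points, hence the division by \<open>norm y\<close>\<close>
  have normalised: "norm (F m y /\<^sub>R norm y) \<le> C" for m y
    using bounded_functional_on_bound[OF F, of m y] C by (cases "y = 0") (auto simp: field_simps)
  obtain k :: "nat \<Rightarrow> nat" where k: "strict_mono k"
    and lim: "\<And>y. y \<in> range d \<Longrightarrow> \<exists>l. (\<lambda>m. F (k m) y /\<^sub>R norm y) \<longlonglongrightarrow> l"
    using function_convergent_subsequence[of "range d" "\<lambda>m y. F m y /\<^sub>R norm y" C,
        OF countable_image[OF countableI_type] normalised]
    by metis
  have conv: "convergent (\<lambda>m. F (k m) (d i))" for i
  proof (cases "d i = 0")
    case True
    then have "F (k m) (d i) = 0" for m
      using bounded_functional_on_bound[OF F, of "k m" "d i"] by simp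
    then show ?thesis by (simp add: convergent_const)
  next
    case False
    obtain l where "(\<lambda>m. F (k m) (d i) /\<^sub>R norm (d i)) \<longlonglongrightarrow> l" using lim by blast
    from tendsto_scaleR[OF tendsto_const this, of "norm (d i)"] False
    show ?thesis by (auto intro: convergentI)
  qed
  have null_k: "(\<lambda>m. F (k m) x) \<longlonglongrightarrow> 0" if "x \<in> X" for x
    using LIMSEQ_subseq_LIMSEQ[OF null[OF that] k] by (simp add: o_def)
  have "convergent (\<lambda>m. F (k m) y)" for y
    by (rule functionals_convergent_if_dense_modulo[OF F C dense null_k conv])
  then obtain h where h: "\<And>y. (\<lambda>m. F (k m) y) \<longlonglongrightarrow> h y"
    unfolding convergent_def by metis
  have "bounded_functional_on s UNIV C h"
    by (rule bounded_functional_on_pointwise_limit[OF F h])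
  moreover have "h x = 0" if "x \<in> X" for x
    using LIMSEQ_unique[OF h null_k[OF that]] .
  ultimately show ?thesis using k h by blast
qed

section \<open>Correction by annihilating functionals\<close>

text \<open>
  Otherwise there are indices \<open>j\<close> tending to infinity and matching \<open>n\<close> for which \<open>f j n\<close> has no such
  \<open>h\<close>. Along a subsequence these functionals converge pointwise; the limit vanishes on \<open>X\<close> and is
  close to them at \<open>d 0, \<dots>, d k\<close>, a contradiction.
\<close>

lemma annihilator_eventually_near:
  fixes f :: "nat \<Rightarrow> 'n \<Rightarrow> 'y::banach \<Rightarrow> 'k::{real_normed_field, euclidean_space}"
  assumes f: "\<And>j n. bounded_functional_on s UNIV C (f j n)" and C: "0 \<le> C"
    and dense: "dense_modulo d X"
    and null: "\<And>x. x \<in> X \<Longrightarrow> uniform_limit UNIV (\<lambda>j n. f j n x) (\<lambda>_. 0) sequentially"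
    and e: "e > 0"
  shows "\<forall>\<^sub>F j in sequentially. \<forall>n. \<exists>h. bounded_functional_on s UNIV C h \<and> (\<forall>x\<in>X. h x = 0) \<and>
           (\<forall>i\<le>k. norm (f j n (d i) - h (d i)) < e)"
proof (rule ccontr)
  let ?near = "\<lambda>j n h. bounded_functional_on s UNIV C h \<and> (\<forall>x\<in>X. h x = 0) \<and>
           (\<forall>i\<le>k. norm (f j n (d i) - h (d i)) < e)"
  assume "\<not> ?thesis"
  then have "\<forall>m. \<exists>j n. j \<ge> m \<and> (\<nexists>h. ?near j n h)"
    unfolding eventually_sequentially by blast
  then obtain J N where J: "\<And>m. J m \<ge> m" and far: "\<And>m. \<nexists>h. ?near (J m) (N m) h"
    by metis
  define F where "F m = f (J m) (N m)" for m :: nat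
  have F: "bounded_functional_on s UNIV C (F m)" for m using f by (simp add: F_def)
  have "(\<lambda>m. F m x) \<longlonglongrightarrow> 0" if x: "x \<in> X" for x
  proof (rule LIMSEQ_I)
    fix r :: real assume "r > 0"
    then obtain M where M: "\<And>j n. j \<ge> M \<Longrightarrow> norm (f j n x) < r"
      using uniform_limitD[OF null[OF x], of r] unfolding eventually_sequentially by auto
    then show "\<exists>M. \<forall>m\<ge>M. norm (F m x - 0) < r"
      using M[OF le_trans[OF _ J]] by (intro exI[of _ M]) (simp add: F_def)
  qed
  from functionals_convergent_subsequence[OF F C dense this]
  obtain \<kappa> h where \<kappa>: "strict_mono (\<kappa> :: nat \<Rightarrow> nat)" and h: "bounded_functional_on s UNIV C h"
    and hX: "\<forall>x\<in>X. h x = 0" and lim: "\<And>y. (\<lambda>m. F (\<kappa> m) y) \<longlonglongrightarrow> h y"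
    by blast
  have "\<forall>\<^sub>F m in sequentially. norm (F (\<kappa> m) (d i) - h (d i)) < e" for i
    using tendstoD[OF lim e] by (simp add: dist_norm)
  then have "\<forall>\<^sub>F m in sequentially. \<forall>i\<in>{..k}. norm (F (\<kappa> m) (d i) - h (d i)) < e"
    by (simp add: eventually_ball_finite)
  then obtain m where "\<forall>i\<in>{..k}. norm (F (\<kappa> m) (d i) - h (d i)) < e"
    using eventually_happens'[OF sequentially_bot] by blast
  then have "?near (J (\<kappa> m)) (N (\<kappa> m)) h" using h hX by (simp add: F_def)
  then show False using far by blast
qed

text \<open>
  Approximation on longer and longer initial pieces of \<open>d\<close> with smaller and smaller error is possible
  from later and later \<open>j\<close> on, so for each \<open>(j, n)\<close> the functional \<open>h j n\<close> is chosen to be as good as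
  possible.
\<close>

lemma annihilator_asymptotic:
  fixes f :: "nat \<Rightarrow> 'n \<Rightarrow> 'y::banach \<Rightarrow> 'k::{real_normed_field, euclidean_space}"
  assumes f: "\<And>j n. bounded_functional_on s UNIV C (f j n)" and C: "0 \<le> C"
    and dense: "dense_modulo d X"
    and null: "\<And>x. x \<in> X \<Longrightarrow> uniform_limit UNIV (\<lambda>j n. f j n x) (\<lambda>_. 0) sequentially"
  shows "\<exists>h. (\<forall>j n. bounded_functional_on s UNIV C (h j n) \<and> (\<forall>x\<in>X. h j n x = 0)) \<and>
           (\<forall>i. uniform_limit UNIV (\<lambda>j n. f j n (d i) - h j n (d i)) (\<lambda>_. 0) sequentially)"
proof -
  define near where "near k j n h \<longleftrightarrow> bounded_functional_on s UNIV C h \<and> (\<forall>x\<in>X. h x = 0) \<and>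
    (\<forall>i\<le>k. norm (f j n (d i) - h (d i)) < 1 / real (Suc k))" for k j n h
  have zero: "bounded_functional_on s UNIV C (\<lambda>_. 0)"
    using C by (simp add: bounded_functional_on_def)
  have mono: "near k j n h" if "near l j n h" "k \<le> l" for k l j n h
  proof -
    have "1 / real (Suc l) \<le> 1 / real (Suc k)" using \<open>k \<le> l\<close> by (simp add: field_simps)
    then show ?thesis using that unfolding near_def by (meson le_trans less_le_trans)
  qed
  \<comment> \<open>the restriction to \<open>k \<le> j\<close> guarantees a best level even if \<open>f j n\<close> can be matched exactly\<close>
  have "\<exists>h. bounded_functional_on s UNIV C h \<and> (\<forall>x\<in>X. h x = 0) \<and>
          (\<forall>k\<le>j. (\<exists>h'. near k j n h') \<longrightarrow> near k j n h)" for j n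
  proof (cases "\<exists>k\<le>j. \<exists>h'. near k j n h'")
    case False
    then show ?thesis using zero by (intro exI[of _ "\<lambda>_. 0"]) auto
  next
    case True
    define K where "K = {k. k \<le> j \<and> (\<exists>h'. near k j n h')}"
    have "finite K" "K \<noteq> {}" using True by (auto simp: K_def)
    then have "Max K \<in> K" and le: "\<And>k. k \<in> K \<Longrightarrow> k \<le> Max K" by auto
    then obtain h where h: "near (Max K) j n h" by (auto simp: K_def)
    then have "\<forall>k\<le>j. (\<exists>h'. near k j n h') \<longrightarrow> near k j n h"
      using le mono by (auto simp: K_def)
    with h show ?thesis unfolding near_def by blast
  qed
  then obtain h where h: "\<And>j n. bounded_functional_on s UNIV C (h j n)" "\<And>j n x. x \<in> X \<Longrightarrow> h j n x = 0"
    and best: "\<And>j n k h'. k \<le> j \<Longrightarrow> near k j n h' \<Longrightarrow> near k j n (h j n)"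
    by metis
  have "uniform_limit UNIV (\<lambda>j n. f j n (d i) - h j n (d i)) (\<lambda>_. 0) sequentially" for i
  proof (rule uniform_limitI)
    fix e :: real assume "e > 0"
    then obtain k0 where k0: "1 / real (Suc k0) < e"
      using nat_approx_posE by metis
    define k where "k = max i k0"
    have k: "1 / real (Suc k) \<le> 1 / real (Suc k0)" by (simp add: k_def field_simps)
    have "\<forall>\<^sub>F j in sequentially. \<forall>n. \<exists>h'. near k j n h'"
      unfolding near_def by (rule annihilator_eventually_near[OF f C dense null]) auto
    then show "\<forall>\<^sub>F j in sequentially. \<forall>n\<in>UNIV. dist (f j n (d i) - h j n (d i)) 0 < e"
      using eventually_ge_at_top[of k]
    proof eventually_elim
      case (elim j)
      have "norm (f j n (d i) - h j n (d i)) < 1 / real (Suc k)" for n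
        using elim best[of k j n] unfolding near_def by (metis k_def max.cobounded1)
      then show ?case using k k0 by (auto intro: less_trans less_le_trans)
    qed
  qed
  then show ?thesis using h by blast
qed

text \<open>
  The Hahn-Banach extensions of the \<open>f j n\<close> minus their asymptotically equal annihilating functionals
  tend to \<open>0\<close> on \<open>X\<close> and along \<open>d\<close>, and by equicontinuity everywhere.
\<close>

lemma uniformly_null_extension:
  fixes f :: "nat \<Rightarrow> 'n \<Rightarrow> 'y::banach \<Rightarrow> 'k::{real_normed_field, euclidean_space}"
  assumes X: "module.subspace s X" and hb: "hahn_banach_property s"
    and f: "\<And>j n. bounded_functional_on s X C (f j n)" and C: "0 \<le> C"
    and dense: "dense_modulo d X"
    and null: "\<And>x. x \<in> X \<Longrightarrow> uniform_limit UNIV (\<lambda>j n. f j n x) (\<lambda>_. 0) sequentially"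
  shows "\<exists>g. (\<forall>j n. bounded_functional_on s UNIV (2 * C) (g j n) \<and> (\<forall>x\<in>X. g j n x = f j n x)) \<and>
           (\<forall>y. uniform_limit UNIV (\<lambda>j n. g j n y) (\<lambda>_. 0) sequentially)"
proof -
  have "\<exists>g. bounded_functional_on s UNIV C g \<and> (\<forall>x\<in>X. g x = f j n x)" for j n
    using hb X C f unfolding hahn_banach_property_def by blast
  then obtain F where F: "\<And>j n. bounded_functional_on s UNIV C (F j n)"
    and F_eq: "\<And>j n x. x \<in> X \<Longrightarrow> F j n x = f j n x"
    by metis
  have nullF: "uniform_limit UNIV (\<lambda>j n. F j n x) (\<lambda>_. 0) sequentially" if "x \<in> X" for x
    using null[OF that] by (simp add: F_eq[OF that])
  obtain h where h: "\<And>j n. bounded_functional_on s UNIV C (h j n)" and hX: "\<And>j n x. x \<in> X \<Longrightarrow> h j n x = 0"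
    and asym: "\<And>i. uniform_limit UNIV (\<lambda>j n. F j n (d i) - h j n (d i)) (\<lambda>_. 0) sequentially"
    using annihilator_asymptotic[OF F C dense nullF] by blast
  define g where "g j n y = F j n y - h j n y" for j n y
  have g: "bounded_functional_on s UNIV (2 * C) (g j n)" for j n
    using bounded_functional_on_minus[OF F h, of j n j n] by (simp add: g_def[abs_def])
  have gX: "g j n x = f j n x" if "x \<in> X" for j n x
    using that by (simp add: g_def hX F_eq)
  have "uniform_limit UNIV (\<lambda>j n. g j n y) (\<lambda>_. 0) sequentially" for y
  proof (rule uniform_limitI)
    fix e :: real assume e: "e > 0"
    define r where "r = e / (3 * (2 * C + 1))"
    have r: "r > 0" "2 * C * r < e / 3" using e C by (auto simp: r_def field_simps)
    obtain i x where x: "x \<in> X" and near: "norm (y - d i - x) < r"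
      using dense r(1) unfolding dense_modulo_def by blast
    have "\<forall>\<^sub>F j in sequentially. \<forall>n\<in>UNIV. dist (g j n (d i)) 0 < e/3"
      using uniform_limitD[OF asym[of i], of "e/3"] e by (simp add: g_def)
    moreover have "\<forall>\<^sub>F j in sequentially. \<forall>n\<in>UNIV. dist (g j n x) 0 < e/3"
      using uniform_limitD[OF null[OF x], of "e/3"] e by (simp add: gX[OF x])
    ultimately show "\<forall>\<^sub>F j in sequentially. \<forall>n\<in>UNIV. dist (g j n y) 0 < e"
    proof eventually_elim
      case (elim j)
      have "norm (g j n y) < e" for n
      proof -
        have "norm (g j n y) \<le> 2 * C * r + norm (g j n (d i)) + norm (g j n x)"
          using bounded_functional_on_le_near[OF g] C near by simp
        moreover have "norm (g j n (d i)) < e/3" "norm (g j n x) < e/3" using elim by auto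
        ultimately show ?thesis using r(2) by linarith
      qed
      then show ?case by simp
    qed
  qed
  then show ?thesis using g gX by blast
qed

section \<open>Separability of the quotient\<close>

lemma dense_modulo_of_countable:
  fixes X :: "'y::real_normed_vector set"
  assumes D: "countable D" and near: "\<And>y e. e > 0 \<Longrightarrow> \<exists>z\<in>D. \<exists>x\<in>X. norm (y - z - x) < e"
  shows "\<exists>d. dense_modulo d X"
proof -
  have "D \<noteq> {}" using near[of 1 0] by auto
  then have "range (from_nat_into D) = D" using D by (rule range_from_nat_into)
  then have "dense_modulo (from_nat_into D) X"
    using near unfolding dense_modulo_def by (metis imageE)
  then show ?thesis by blast
qed

lemma separable_space_dense_modulo:
  fixes X :: "'y::banach set"
  assumes "separable_space (euclidean :: 'y topology)" and X: "0 \<in> X"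
  shows "\<exists>d. dense_modulo d X"
proof -
  obtain D :: "'y set" where D: "countable D" "closure D = UNIV"
    using assms(1) by (auto simp: separable_space_def)
  have "\<exists>z\<in>D. \<exists>x\<in>X. norm (y - z - x) < e" if "e > 0" for y e
  proof -
    have "y \<in> closure D" using D by simp
    then obtain z where "z \<in> D" "dist z y < e" using \<open>e > 0\<close> closure_approachable by blast
    then show ?thesis using X by (intro bexI[of _ z] bexI[of _ 0]) (auto simp: dist_norm norm_minus_commute)
  qed
  then show ?thesis using D(1) by (rule dense_modulo_of_countable[rotated])
qed

text \<open>
  Representatives of a countable dense set of cosets serve as the sequence, since the quotient
  distance is an infimum over \<open>X\<close>.
\<close>

lemma separable_quotient_dense_modulo:
  fixes X :: "'y::banach set"
  assumes X: "subspace X" and cl: "closed X" and sep: "separable_quotient X"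
  shows "\<exists>d. dense_modulo d X"
proof -
  interpret Q: Metric_space "cosets X" setdist using X cl by (rule Metric_space_cosets)
  obtain D where D: "countable D" "D \<subseteq> cosets X" "Q.mtopology closure_of D = cosets X"
    using sep unfolding separable_quotient_def separable_space_def by auto
  have "\<forall>A\<in>D. \<exists>z. A = (+) z ` X" using D(2) unfolding cosets_def by blast
  then obtain rep where rep: "\<And>A. A \<in> D \<Longrightarrow> A = (+) (rep A) ` X" by metis
  have "\<exists>z\<in>rep ` D. \<exists>x\<in>X. norm (y - z - x) < e" if "e > 0" for y e
  proof -
    have "(+) y ` X \<in> Q.mtopology closure_of D" using D(3) by (auto simp: cosets_def)
    then obtain A where A: "A \<in> D" "setdist ((+) y ` X) A < e"
      using \<open>e > 0\<close> unfolding Q.metric_closure_of by auto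
    then have "setdist ((+) y ` X) ((+) (rep A) ` X) < e" using rep by metis
    then have "(INF x\<in>X. norm (y - rep A + x)) < e" by (simp add: setdist_cosets[OF X])
    moreover have "X \<noteq> {}" using subspace_0[OF X] by auto
    ultimately obtain x where "x \<in> X" "norm (y - rep A + x) < e"
      using cInf_lessD[of "(\<lambda>x. norm (y - rep A + x)) ` X" e] by auto
    then have "- x \<in> X" "norm (y - rep A - (- x)) < e" using subspace_neg[OF X] by auto
    then show ?thesis using A(1) by blast
  qed
  moreover have "countable (rep ` D)" using D(1) by simp
  ultimately show ?thesis by (rule dense_modulo_of_countable[rotated])
qed

section \<open>Operators into the null sequences of bounded sequences\<close>

text \<open>
  Uniform convergence to \<open>0\<close> of the coordinate functionals is exactly what puts the values of an
  operator assembled from them into \<open>c\<^sub>0(\<ell>\<^sup>\<infinity>)\<close>.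
\<close>

lemma c0_linfty_extension:
  fixes s :: "'k::{real_normed_field, euclidean_space} \<Rightarrow> 'y::banach \<Rightarrow> 'y"
    and T :: "'y \<Rightarrow> 'k linfty c0"
  assumes X: "module.subspace s X" and hb: "hahn_banach_property s" and dense: "dense_modulo d X"
    and T: "bounded_linear_op_on s c0_linfty_scale X T"
    and C: "0 \<le> C" and bound: "\<And>x. x \<in> X \<Longrightarrow> norm (T x) \<le> C * norm x"
  shows "\<exists>T'. bounded_linear_op_on s c0_linfty_scale UNIV T' \<and> (\<forall>x\<in>X. T' x = T x) \<and>
           (\<forall>y. norm (T' y) \<le> 2 * C * norm y)"
proof -
  note rep = c0_linfty_scale.rep_eq linfty_scale.rep_eq plus_c0.rep_eq plus_bcontfun.rep_eq
  define f where "f j n x = c0_nth (T x) j n" for j n x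
  have f_le: "norm (f j n x) \<le> norm (c0_nth (T x) j)" for j n x
    unfolding f_def by (rule norm_bounded)
  have "bounded_functional_on s X C (f j n)" for j n
    unfolding bounded_functional_on_def
  proof (intro conjI ballI allI)
    fix x assume "x \<in> X"
    then show "norm (f j n x) \<le> C * norm x"
      using f_le[of j n x] norm_c0_nth_le[of "T x" j] bound[of x] by linarith
  qed (use T in \<open>auto simp: f_def bounded_linear_op_on_def rep\<close>)
  moreover have "uniform_limit UNIV (\<lambda>j n. f j n x) (\<lambda>_. 0) sequentially" for x
  proof (rule uniform_limitI)
    fix e :: real assume "e > 0"
    then have "\<forall>\<^sub>F j in sequentially. norm (c0_nth (T x) j) < e"
      using order_tendstoD(2)[OF c0_nth_norm_LIMSEQ] by blast
    then show "\<forall>\<^sub>F j in sequentially. \<forall>n\<in>UNIV. dist (f j n x) 0 < e"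
      by eventually_elim (auto intro: le_less_trans[OF f_le])
  qed
  ultimately obtain g where g: "\<And>j n. bounded_functional_on s UNIV (2 * C) (g j n)"
    and gX: "\<And>j n x. x \<in> X \<Longrightarrow> g j n x = f j n x"
    and null: "\<And>y. uniform_limit UNIV (\<lambda>j n. g j n y) (\<lambda>_. 0) sequentially"
    using uniformly_null_extension[OF X hb _ C dense, of f] by blast
  define b where "b y j = Bcontfun (\<lambda>n. g j n y)" for y and j :: nat
  have b: "apply_bcontfun (b y j) n = g j n y" for y j n
  proof -
    have "(\<lambda>n. g j n y) \<in> bcontfun"
      by (rule bcontfun_normI[OF Topological_Spaces.continuous_on_discrete, of _ "2 * C * norm y"])
        (rule bounded_functional_on_bound[OF g])
    then show ?thesis by (simp add: b_def Bcontfun_inverse)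
  qed
  have "(\<lambda>j. norm (b y j)) \<longlonglongrightarrow> 0" for y
  proof (rule LIMSEQ_I)
    fix e :: real assume e: "e > 0"
    then obtain M where M: "\<And>j n. j \<ge> M \<Longrightarrow> norm (g j n y) < e/2"
      using uniform_limitD[OF null[of y], of "e/2"] unfolding eventually_sequentially by auto
    have "norm (b y j) < e" if "j \<ge> M" for j
    proof -
      have "norm (b y j) \<le> e/2" by (rule norm_bound) (use M[OF that] in \<open>simp add: b less_imp_le\<close>)
      then show ?thesis using e by simp
    qed
    then show "\<exists>M. \<forall>j\<ge>M. norm (norm (b y j) - 0) < e" by auto
  qed
  then have nth: "c0_nth (Abs_c0 (b y)) = b y" for y by (simp add: Abs_c0_inverse)
  define T' where "T' y = Abs_c0 (b y)" for y
  have T': "c0_nth (T' y) j n = g j n y" for y j n by (simp add: T'_def nth b)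
  have norm_T': "norm (T' y) \<le> 2 * C * norm y" for y
    by (intro norm_c0_le norm_bound) (simp add: T' bounded_functional_on_bound[OF g])
  have "bounded_linear_op_on s c0_linfty_scale UNIV T'"
    unfolding bounded_linear_op_on_def
  proof (intro conjI ballI allI exI)
    show "T' (x + y) = T' x + T' y" for x y
      by (intro c0_eqI bcontfun_eqI)
        (use g in \<open>simp add: T' rep bounded_functional_on_def\<close>)
    show "T' (s a x) = c0_linfty_scale a (T' x)" for a x
      by (intro c0_eqI bcontfun_eqI)
        (use g in \<open>simp add: T' rep bounded_functional_on_def\<close>)
  qed (rule norm_T')
  moreover have "T' x = T x" if "x \<in> X" for x
    by (intro c0_eqI bcontfun_eqI) (simp add: T' gX[OF that] f_def)
  ultimately show ?thesis using norm_T' by blast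
qed

lemma onorm_on_bound:
  assumes "bounded_linear_op_on s t X T" and "0 \<in> X"
  shows "0 \<le> onorm_on X T" and "x \<in> X \<Longrightarrow> norm (T x) \<le> onorm_on X T * norm x"
proof -
  obtain K where K: "\<And>x. x \<in> X \<Longrightarrow> norm (T x) \<le> K * norm x"
    using assms(1) unfolding bounded_linear_op_on_def by blast
  have "norm (T x) / norm x \<le> max K 0" if "x \<in> X" for x
  proof (cases "x = 0")
    case False
    then have "norm (T x) / norm x \<le> K" using K[OF that] by (simp add: field_simps)
    then show ?thesis by simp
  qed simp
  then have "bdd_above ((\<lambda>x. norm (T x) / norm x) ` X)" by (intro bdd_aboveI2)
  then have le: "norm (T x) / norm x \<le> onorm_on X T" if "x \<in> X" for x
    unfolding onorm_on_def using that by (rule cSUP_upper[rotated])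
  show "0 \<le> onorm_on X T" using le[OF assms(2)] by simp
  show "norm (T x) \<le> onorm_on X T * norm x" if "x \<in> X"
    using le[OF that] K[OF that] by (cases "x = 0") (auto simp: field_simps)
qed

lemma c0_linfty_separable_extension_property:
  assumes hb: "\<And>s :: 'k::{real_normed_field, euclidean_space} \<Rightarrow> 'y::banach \<Rightarrow> 'y.
      banach_scaling s \<Longrightarrow> hahn_banach_property s"
    and l: "2 \<le> l"
  shows "separable_extension_property TYPE('y) l (c0_linfty_scale :: 'k \<Rightarrow> 'k linfty c0 \<Rightarrow> 'k linfty c0)"
  unfolding separable_extension_property_def
proof (intro impI allI, elim conjE)
  fix s :: "'k \<Rightarrow> 'y \<Rightarrow> 'y" and X and T :: "'y \<Rightarrow> 'k linfty c0"
  assume sep: "separable_space (euclidean :: 'y topology)" and s: "banach_scaling s"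
    and X: "module.subspace s X" and T: "bounded_linear_op_on s c0_linfty_scale X T"
  have X0: "0 \<in> X" using subspace_0[OF subspace_if_scaling_subspace[OF s X]] .
  obtain d where "dense_modulo d X" using separable_space_dense_modulo[OF sep X0] by blast
  from c0_linfty_extension[OF X hb[OF s] this T onorm_on_bound[OF T X0]]
  obtain T' where T': "bounded_linear_op_on s c0_linfty_scale UNIV T'" "\<forall>x\<in>X. T' x = T x"
    and le: "\<And>y. norm (T' y) \<le> 2 * onorm_on X T * norm y"
    by blast
  have "onorm T' \<le> 2 * onorm_on X T"
    using onorm_on_bound(1)[OF T X0] le by (intro onorm_bound) auto
  also have "\<dots> \<le> l * onorm_on X T"
    using l onorm_on_bound(1)[OF T X0] by (rule mult_right_mono)
  finally show "\<exists>T'. bounded_linear_op_on s c0_linfty_scale UNIV T' \<and> (\<forall>x\<in>X. T' x = T x) \<and>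
      onorm T' \<le> l * onorm_on X T"
    using T' by blast
qed

text \<open>
  The range is closed because it is complete, being isometric to a Banach space.
\<close>

lemma isometric_embedding_range:
  fixes t :: "'k::real_normed_field \<Rightarrow> 'z::banach \<Rightarrow> 'z" and s :: "'k \<Rightarrow> 'y::banach \<Rightarrow> 'y"
  assumes t: "banach_scaling t" and s: "banach_scaling s" and J: "isometric_embedding t s J"
  shows "module.subspace s (range J)" and "closed (range J)" and "inj J"
proof -
  have lin: "Vector_Spaces.linear t s J" and nJ: "\<And>z. norm (J z) = norm z"
    using J by (auto simp: isometric_embedding_def)
  interpret J: Vector_Spaces.linear t s J by (rule lin)
  show "module.subspace s (range J)"
    using J.subspace_image[OF module.subspace_UNIV[OF banach_scaling_module[OF t]]] .
  show "inj J"
  proof (rule injI)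
    fix x y assume "J x = J y"
    then have "norm (x - y) = 0" using nJ[of "x - y"] by (simp add: J.diff)
    then show "x = y" by simp
  qed
  have "bounded_linear J"
  proof (rule bounded_linear_intro)
    show "J (r *\<^sub>R x) = r *\<^sub>R J x" for r x
      using J.scale[of "of_real r" x] by (simp add: banach_scaling_of_real[OF s] banach_scaling_of_real[OF t])
    show "norm (J x) \<le> norm x * 1" for x by (simp add: nJ)
  qed (rule J.add)
  then have "complete (range J)"
    using complete_isometric_image[of 1 UNIV J] by (simp add: nJ complete_UNIV)
  then show "closed (range J)" by (rule complete_imp_closed)
qed

text \<open>
  The projection is \<open>J \<circ> T\<close>, where \<open>T\<close> extends the inverse of \<open>J\<close>, an operator of norm at most \<open>1\<close>,
  from the range of \<open>J\<close> to the whole space.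
\<close>

lemma c0_linfty_complemented:
  fixes s :: "'k::{real_normed_field, euclidean_space} \<Rightarrow> 'y::banach \<Rightarrow> 'y"
    and J :: "'k linfty c0 \<Rightarrow> 'y"
  assumes s: "banach_scaling s" and hb: "hahn_banach_property s"
    and J: "isometric_embedding c0_linfty_scale s J" and sep: "separable_quotient (range J)"
    and l: "2 \<le> l"
  shows "complemented l s (range J)"
proof -
  note range = isometric_embedding_range[OF banach_scaling_c0_linfty s J]
  have lin: "Vector_Spaces.linear c0_linfty_scale s J" and nJ: "\<And>z. norm (J z) = norm z"
    using J by (auto simp: isometric_embedding_def)
  interpret J: Vector_Spaces.linear c0_linfty_scale s J by (rule lin)
  obtain d where dense: "dense_modulo d (range J)"
    using separable_quotient_dense_modulo[OF subspace_if_scaling_subspace[OF s range(1)] range(2) sep]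
    by blast
  have inv: "inv J (J z) = z" for z using range(3) by (rule inv_f_f)
  have le: "norm (inv J x) \<le> 1 * norm x" if "x \<in> range J" for x
    using that by (auto simp: inv nJ)
  have "bounded_linear_op_on s c0_linfty_scale (range J) (inv J)"
    unfolding bounded_linear_op_on_def
  proof (intro conjI ballI allI exI)
    show "inv J (x + y) = inv J x + inv J y" if "x \<in> range J" "y \<in> range J" for x y
      using that by (auto simp: inv J.add[symmetric])
    show "inv J (s a x) = c0_linfty_scale a (inv J x)" if "x \<in> range J" for a x
      using that by (auto simp: inv J.scale[symmetric])
  qed (rule le)
  from c0_linfty_extension[OF range(1) hb dense this _ le]
  obtain T where T: "bounded_linear_op_on s c0_linfty_scale UNIV T"
    and T_inv: "\<And>x. x \<in> range J \<Longrightarrow> T x = inv J x" and nT: "\<And>y. norm (T y) \<le> 2 * 1 * norm y"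
    by auto
  define P where "P y = J (T y)" for y
  have "bounded_linear_op_on s s UNIV P"
    using T nT by (auto simp: bounded_linear_op_on_def P_def J.add J.scale nJ)
  moreover have P_id: "P x = x" if "x \<in> range J" for x
    using that by (auto simp: P_def T_inv inv)
  moreover have "range P = range J"
  proof
    show "range P \<subseteq> range J" by (auto simp: P_def)
    show "range J \<subseteq> range P" using P_id by (metis rangeI subsetI)
  qed
  moreover have "onorm P \<le> l"
  proof (rule onorm_bound)
    show "norm (P y) \<le> l * norm y" for y
      using nT[of y] mult_right_mono[OF l norm_ge_zero[of y]] by (simp add: P_def nJ)
  qed (use l in simp)
  ultimately show ?thesis unfolding complemented_def by blast
qed

theorem corollary1p4:
  fixes \<epsilon> :: real
  assumes "\<epsilon> > 0"
  shows
    "separable_extension_property TYPE('y::banach) (2 + \<epsilon>)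
       (c0_linfty_scale :: real \<Rightarrow> real linfty c0 \<Rightarrow> real linfty c0) \<and>
     (\<forall>(s :: real \<Rightarrow> 'y \<Rightarrow> 'y) (J :: real linfty c0 \<Rightarrow> 'y).
        banach_scaling s \<and> isometric_embedding c0_linfty_scale s J \<and> separable_quotient (range J) \<longrightarrow>
        complemented (2 + \<epsilon>) s (range J)) \<and>
     separable_extension_property TYPE('y) (2 + \<epsilon>)
       (c0_linfty_scale :: complex \<Rightarrow> complex linfty c0 \<Rightarrow> complex linfty c0) \<and>
     (\<forall>(s :: complex \<Rightarrow> 'y \<Rightarrow> 'y) (J :: complex linfty c0 \<Rightarrow> 'y).
        banach_scaling s \<and> isometric_embedding c0_linfty_scale s J \<and> separable_quotient (range J) \<longrightarrow>
        complemented (2 + \<epsilon>) s (range J))"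
proof -
  have l: "2 \<le> 2 + \<epsilon>" using assms by simp
  show ?thesis
    using l c0_linfty_separable_extension_property[OF hahn_banach_property_real l]
      c0_linfty_separable_extension_property[OF hahn_banach_property_complex l]
      c0_linfty_complemented[OF _ hahn_banach_property_real] c0_linfty_complemented[OF _ hahn_banach_property_complex]
    by blast
qed

end
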